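(* Let $N\ge 3$ and $k,\ell\ge 0$ be integers. For the game $CSG(I_N)$, $$\mathcal{G}_{I_N}(S_{1,k,\ell})=\begin{cases}\mathcal{G}_{I_N}(S_{1,(k \bmod (N+1))+N+1,\,N}) & \text{if } k>N \text{ and } \ell\equiv N \pmod{N+1},\\ \mathcal{G}_{I_N}(S_{1,N,\,(\ell \bmod (N+1))+N+1}) & \text{if } \ell>N \text{ and } k\equiv N \pmod{N+1},\\ \mathcal{G}_{I_N}(S_{1,\,k \bmod (N+1),\,\ell \bmod (N+1)}) & \text{otherwise.}\end{cases}$$
   Context: $I_N=\{1,\ldots,N\}$. For a set $L$ of positive integers, the game $CSG(L)$ on a connected graph $G$ is the two-player impartial game in which a move consists in removing from the current graph a connected subgraph $H$ such that $|V(H)|\in L$ and the remaining graph is connected (the empty graph counts as connected, so removing the whole graph is allowed when its size is in $L$). The player unable to move loses. $\mathcal{G}_L(G)$ is the Grundy value of $CSG(L)$ on $G$. The subdivided star $S_{\ell_1,\ldots,\ell_t}$ is obtained from a single (central) vertex by attaching $t$ disjoint paths with $\ell_1,\ldots,\ell_t$ vertices respectively (an endpoint of each path adjacent to the center; paths with $0$ vertices are allowed). Thus $S_{1,k,\ell}$ has $k+\ell+2$ vertices. *)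

theory Defs
  imports "Graph_Theory.Digraph_Component"
begin

definition mex :: "nat set \<Rightarrow> nat" where
  "mex A = (LEAST n. n \<notin> A)"

text \<open>
  Undirected simple graphs are the symmetric digraphs of locale \<^locale>\<open>graph\<close>.
  As \<^const>\<open>connected\<close> excludes the empty graph, a removed subgraph is never empty, and
  the case of an empty remaining graph is stated separately.  Only the vertex set of the
  removed subgraph matters: deleting it also deletes all incident edges.
\<close>

definition csg_move :: "nat set \<Rightarrow> ('a, 'b) pre_digraph \<Rightarrow> ('a, 'b) pre_digraph \<Rightarrow> bool" where
  "csg_move L G G' \<longleftrightarrow> graph G \<and>
     (\<exists>H. subgraph H G \<and> connected H \<and> card (verts H) \<in> L \<and>
          G' = G \<restriction> (verts G - verts H) \<and> (verts G' = {} \<or> connected G'))"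

lemma csg_move_card_less:
  assumes "csg_move L G G'"
  shows "card (verts G') < card (verts G)"
proof -
  obtain H where G: "graph G" and H: "subgraph H G" "connected H"
    and G': "G' = G \<restriction> (verts G - verts H)"
    using assms unfolding csg_move_def by blast
  interpret graph G by (rule G)
  have "verts H \<noteq> {}" "verts H \<subseteq> verts G"
    using H by (auto simp: connected_def strongly_connected_def subgraph_def)
  then have "verts G' \<subset> verts G"
    unfolding G' by auto
  then show ?thesis by (simp add: psubset_card_mono)
qed

function csg_grundy :: "nat set \<Rightarrow> ('a, 'b) pre_digraph \<Rightarrow> nat" where
  "csg_grundy L G = mex (csg_grundy L ` {G'. csg_move L G G'})"
  by pat_completeness auto
termination
  by (relation "measure (\<lambda>(L, G). card (verts G))") (auto dest: csg_move_card_less)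

declare csg_grundy.simps [simp del]

text \<open>
  The centre is \<^term>\<open>None\<close>, and \<^term>\<open>Some (i, j)\<close> is the vertex at distance \<^term>\<open>Suc j\<close>
  from the centre on the \<^term>\<open>i\<close>-th path.
\<close>

definition star_verts :: "nat list \<Rightarrow> (nat \<times> nat) option set" where
  "star_verts ls = insert None {Some (i, j) |i j. i < length ls \<and> j < ls ! i}"

definition star_links :: "nat list \<Rightarrow> (nat \<times> nat) option rel" where
  "star_links ls =
     {(None, Some (i, 0)) |i. i < length ls \<and> 0 < ls ! i} \<union>
     {(Some (i, j), Some (i, Suc j)) |i j. i < length ls \<and> Suc j < ls ! i}"

definition subdivided_star ::
  "nat list \<Rightarrow> ((nat \<times> nat) option, (nat \<times> nat) option \<times> (nat \<times> nat) option) pre_digraph" where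
  "subdivided_star ls =
     \<lparr>verts = star_verts ls, arcs = star_links ls \<union> (star_links ls)\<inverse>, tail = fst, head = snd\<rparr>"

lemma star_verts_conv:
  "star_verts ls = insert None (Some ` (SIGMA i:{..<length ls}. {..<ls ! i}))"
  by (auto simp: star_verts_def)

lemma card_subdivided_star: "card (verts (subdivided_star ls)) = Suc (sum_list ls)"
  unfolding subdivided_star_def star_verts_conv
  by (simp add: card_image card_insert_if image_iff sum_list_sum_nth atLeast0LessThan)

lemma graph_subdivided_star: "graph (subdivided_star ls)"
proof -
  have links: "star_links ls \<subseteq> star_verts ls \<times> star_verts ls"
    by (auto simp: star_links_def star_verts_def)
  have "finite (star_verts ls)"
    by (simp add: star_verts_conv)
  then have fin: "finite (star_links ls)"
    using links by (meson finite_SigmaI finite_subset)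
  interpret digraph "subdivided_star ls"
    using links \<open>finite (star_verts ls)\<close> fin
    by unfold_locales (auto simp: subdivided_star_def arc_to_ends_def star_links_def star_verts_def)
  have "symmetric (subdivided_star ls)"
    by (auto simp: symmetric_def arcs_ends_conv subdivided_star_def sym_Un_converse)
  then show ?thesis ..
qed

lemma connected_subdivided_star: "connected (subdivided_star ls)"
proof -
  let ?S = "subdivided_star ls"
  interpret graph ?S by (rule graph_subdivided_star)
  have arc: "u \<rightarrow>\<^bsub>?S\<^esub> v" if "(u, v) \<in> star_links ls" for u v
    using that by (force simp: arcs_ends_conv subdivided_star_def)
  have path: "None \<rightarrow>\<^sup>*\<^bsub>?S\<^esub> Some (i, j)" if "i < length ls" "j < ls ! i" for i j
    using that
  proof (induction j)
    case 0
    then have "None \<rightarrow>\<^bsub>?S\<^esub> Some (i, 0)" by (intro arc) (simp add: star_links_def)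
    then show ?case by (rule reachable_adjI)
  next
    case (Suc j)
    then have "Some (i, j) \<rightarrow>\<^bsub>?S\<^esub> Some (i, Suc j)" by (intro arc) (simp add: star_links_def)
    with Suc show ?case by (meson Suc_lessD reachable_adj_trans)
  qed
  have centre: "None \<rightarrow>\<^sup>*\<^bsub>?S\<^esub> v" if "v \<in> verts ?S" for v
  proof (cases v)
    case None
    with that show ?thesis by simp
  next
    case (Some p)
    with that show ?thesis
      by (cases p) (auto simp: subdivided_star_def star_verts_def
            intro!: path[unfolded subdivided_star_def star_verts_def])
  qed
  have "u \<rightarrow>\<^sup>*\<^bsub>?S\<^esub> v" if "u \<in> verts ?S" "v \<in> verts ?S" for u v
    using centre that by (meson reachable_trans symmetric_reachable')
  then have "strongly_connected ?S"
    by (auto simp: strongly_connected_def subdivided_star_def star_verts_def)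
  then show ?thesis
    by (auto simp: connected_def strongly_connected_def reachable_mk_symmetricI)
qed

end

theory Submission
  imports Defs
begin

text \<open>
  Write \<open>M = N + 1\<close> and \<open>g k l\<close> for the Grundy value of the star \<open>[1, k, l]\<close>.  Deleting vertices
  leaves a shorter star or a path, and a path with \<open>n\<close> vertices has value \<open>n mod M\<close>, so \<open>g\<close> satisfies
  a closed mex recursion.

  If neither \<open>k\<close> nor \<open>l\<close> is \<open>N\<close> modulo \<open>M\<close>, then \<open>g k l = g (k mod M) (l mod M)\<close>: shortening an arm
  by \<open>i\<close> can be followed by shortening it by \<open>M - i\<close>, and the values below \<open>g (k mod M) (l mod M)\<close>
  that come from swallowing the centre (possible only for short arms) reappear in the region
  \<open>N - 1 \<le> k + l\<close>, \<open>k, l < N\<close>, where \<open>g k l = k + l + 1 - N\<close>.  If both are \<open>N\<close> modulo \<open>M\<close>, the value is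
  \<open>0\<close>.

  The delicate case is \<open>k = N\<close>.  Put \<open>a x = g N x\<close> and \<open>b x = g N (x + M)\<close> for \<open>x < N\<close>.  If \<open>a x \<le> N\<close> then
  \<open>a x = b x = x + 1\<close>.  Where \<open>a x > N\<close>, \<open>a\<close> is strictly increasing, and \<open>b x > N\<close> implies
  \<open>b x \<le> a x\<close>.  Hence every \<open>w\<close> with \<open>N < w < b x\<close> is already some \<open>b z\<close> with \<open>z < x\<close>, so passing from
  \<open>x + M\<close> to \<open>x + 2 * M\<close> loses no option: this column is periodic from \<open>M\<close> on, but not from \<open>0\<close>.
\<close>

section \<open>The mex recursion\<close>

lemma mex_notin: "finite A \<Longrightarrow> mex A \<notin> A"
  unfolding mex_def by (rule LeastI_ex) (rule ex_new_if_finite[OF infinite_UNIV_nat])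

lemma less_mex: "u < mex A \<Longrightarrow> u \<in> A"
  unfolding mex_def using not_less_Least by blast

lemma mex_eqI: "v \<notin> A \<Longrightarrow> (\<And>u. u < v \<Longrightarrow> u \<in> A) \<Longrightarrow> mex A = v"
  unfolding mex_def by (rule Least_equality) (auto intro: leI)

text \<open>A legal shortening removes between 1 and \<open>N\<close> vertices, never a multiple of
  \<open>Suc N\<close>.\<close>

lemma mod_window: "x < k \<Longrightarrow> k \<le> x + N \<Longrightarrow> x mod Suc N \<noteq> k mod Suc N"
  using mod_eq_dvd_iff_nat[of x k "Suc N"] by (auto dest: dvd_imp_le)

lemma div_expand: "x = Suc N * (x div Suc N) + x mod Suc N"
  by (rule mult_div_mod_eq[symmetric])

lemma mult_add_mod: "y < Suc N \<Longrightarrow> (Suc N * q + y) mod Suc N = y"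
  by (simp only: mod_mult_self4 mod_less)

text \<open>The witness lies in the same block of length \<open>Suc N\<close> as \<open>k\<close>,
  so one shortening reaches every smaller residue.\<close>

lemma lift_mod:
  assumes "x < k mod Suc N"
  obtains z where "z < k" "k \<le> z + N" "z mod Suc N = x"
proof
  let ?z = "Suc N * (k div Suc N) + x"
  note k = div_expand[of k N]
  show "?z < k" "k \<le> ?z + N"
    using k assms mod_less_divisor[of "Suc N" k] by linarith+
  show "?z mod Suc N = x" using assms mod_less_divisor[of "Suc N" k] by (intro mult_add_mod) linarith
qed

text \<open>
  The last two disjuncts are the moves that take the centre and leave the outer part of a long arm.
  The move that leaves only the leaf is not listed: its value \<open>1\<close> is always an option anyway.
\<close>

definition star_opt :: "nat \<Rightarrow> (nat \<Rightarrow> nat \<Rightarrow> nat) \<Rightarrow> nat \<Rightarrow> nat \<Rightarrow> nat \<Rightarrow> bool" where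
  "star_opt N g k l u \<longleftrightarrow>
     (\<exists>x<k. k \<le> x + N \<and> u = g x l) \<or> (\<exists>y<l. l \<le> y + N \<and> u = g k y) \<or>
     u = (k + l + 1) mod Suc N \<or>
     (\<exists>x\<le>k. k + l + 2 \<le> x + N \<and> u = x mod Suc N) \<or>
     (\<exists>y\<le>l. k + l + 2 \<le> y + N \<and> u = y mod Suc N)"

text \<open>Isolates the arithmetic: everything about \<open>g\<close> is derived from this
  recursion, and the graph-theoretic sections only have to instantiate it.\<close>

locale star_game =
  fixes N :: nat and g :: "nat \<Rightarrow> nat \<Rightarrow> nat"
  assumes N_pos: "0 < N"
    and g_mex: "g k l = mex {u. star_opt N g k l u}"
begin

abbreviation "M \<equiv> Suc N"
abbreviation "opt \<equiv> star_opt N g"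

lemma finite_opt: "finite {u. opt k l u}"
proof -
  have "{u. opt k l u} \<subseteq> (\<lambda>x. g x l) ` {..<k} \<union> g k ` {..<l} \<union> {..N}"
    by (auto simp: star_opt_def less_Suc_eq_le[symmetric])
  then show ?thesis by (rule finite_subset) auto
qed

lemma not_opt: "\<not> opt k l (g k l)"
  using mex_notin[OF finite_opt, of k l] g_mex[of k l] by auto

lemma opt_less: "u < g k l \<Longrightarrow> opt k l u"
  using less_mex[of u "{u. opt k l u}"] g_mex[of k l] by auto

lemma g_eqI: "\<not> opt k l v \<Longrightarrow> (\<And>u. u < v \<Longrightarrow> opt k l u) \<Longrightarrow> g k l = v"
  unfolding g_mex[of k l] by (rule mex_eqI) auto

lemma opt_left: "x < k \<Longrightarrow> k \<le> x + N \<Longrightarrow> opt k l (g x l)"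
  and opt_right: "y < l \<Longrightarrow> l \<le> y + N \<Longrightarrow> opt k l (g k y)"
  and opt_leaf: "opt k l ((k + l + 1) mod M)"
  and opt_arm_left: "x \<le> k \<Longrightarrow> k + l + 2 \<le> x + N \<Longrightarrow> opt k l (x mod M)"
  by (auto simp: star_opt_def)

lemma opt_cases [consumes 1, case_names left right leaf arm_left arm_right]:
  assumes "opt k l u"
  obtains x where "x < k" "k \<le> x + N" "u = g x l"
  | y where "y < l" "l \<le> y + N" "u = g k y"
  | "u = (k + l + 1) mod M"
  | x where "x \<le> k" "k + l + 2 \<le> x + N" "u = x mod M"
  | y where "y \<le> l" "k + l + 2 \<le> y + N" "u = y mod M"
  using assms unfolding star_opt_def by blast

lemma left_neq: "x < k \<Longrightarrow> k \<le> x + N \<Longrightarrow> g x l \<noteq> g k l"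
  using not_opt[of k l] opt_left by metis

lemma right_neq: "y < l \<Longrightarrow> l \<le> y + N \<Longrightarrow> g k y \<noteq> g k l"
  using not_opt[of k l] opt_right by metis

lemma g_commute: "g k l = g l k"
proof (induction "k + l" arbitrary: k l rule: less_induct)
  case less
  have "opt k l u \<longleftrightarrow> opt l k u" for u
    unfolding star_opt_def
    using less.hyps[of _ l] less.hyps[of k] by (auto simp: add.commute add.left_commute)
  then show ?case using g_mex by simp
qed

lemma opt_swap: "opt k l u \<longleftrightarrow> opt l k u"
  unfolding star_opt_def using g_commute by (auto simp: add.commute add.left_commute)

section \<open>Bounds and exact values for short arms\<close>

lemma g_le_vertices: "g k l \<le> k + l + 2"
proof (induction "k + l" arbitrary: k l rule: less_induct)
  case less
  \<comment> \<open>The number of vertices is never an option: each option is the value of a smaller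
    star, bounded by induction, or a residue of a smaller number.\<close>
  have "\<not> opt k l (k + l + 2)"
  proof
    assume "opt k l (k + l + 2)"
    then show False
    proof (cases rule: opt_cases)
      case (left x)
      then show ?thesis using less[of x l] by simp
    next
      case (right y)
      then show ?thesis using less[of k y] by simp
    next
      case leaf
      then show ?thesis using mod_less_eq_dividend[of "k + l + 1" M] by linarith
    next
      case (arm_left x)
      then show ?thesis using mod_less_eq_dividend[of x M] by linarith
    next
      case (arm_right y)
      then show ?thesis using mod_less_eq_dividend[of y M] by linarith
    qed
  qed
  then show ?case using opt_less not_le by blast
qed

text \<open>On at most \<open>N\<close> vertices, a single move can take the centre and leave any
  \<open>x <= k\<close> vertices of the left arm, so all values up to \<open>k\<close> are
  options.\<close>

lemma greater_left:
  assumes "k + l + 2 \<le> N"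
  shows "k < g k l"
proof (rule ccontr)
  assume "\<not> k < g k l"
  then have "opt k l (g k l mod M)" using assms by (intro opt_arm_left) auto
  moreover have "g k l mod M = g k l" using \<open>\<not> k < g k l\<close> assms by simp
  ultimately show False using not_opt by simp
qed

lemma greater_right: "k + l + 2 \<le> N \<Longrightarrow> l < g k l"
  using greater_left[of l k] g_commute[of k l] by (simp add: add.commute)

text \<open>Shortening an arm inside the region lowers the value by the number of vertices removed.
  Leaving the region gives a value above the untouched arm, hence too large. Moves through the
  centre leave at least \<open>k + l + 2 - N\<close> vertices, and the path option has residue
  \<open>N\<close> or one less than the claimed value.\<close>

lemma large_base:
  assumes "k < N" "l < N" "N \<le> k + l + 1"
  shows "g k l = k + l + 1 - N"
  using assms
proof (induction "k + l" arbitrary: k l rule: less_induct)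
  case less
  note prems = less.prems
  show ?case
  proof (rule g_eqI)
    have left_ne: "g x b \<noteq> a + b + 1 - N"
      if "x < a" "a + b = k + l" "a < N" "b < N" for x a b
    proof (cases "N \<le> x + b + 1")
      case True
      then have "g x b = x + b + 1 - N" using less.hyps[of x b] that by simp
      then show ?thesis using that True by linarith
    next
      case False
      then show ?thesis using greater_right[of x b] that by linarith
    qed
    show "\<not> opt k l (k + l + 1 - N)"
    proof
      assume "opt k l (k + l + 1 - N)"
      then show False
      proof (cases rule: opt_cases)
        case (left x)
        then show ?thesis using left_ne[of x k l] prems by simp
      next
        case (right y)
        then show ?thesis using left_ne[of y l k] prems g_commute[of y k] by (simp add: add.commute)
      next
        case leaf
        then show ?thesis using prems by (cases "k + l + 1 = N") (auto simp: le_mod_geq)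
      next
        case (arm_left x)
        then show ?thesis using prems by simp
      next
        case (arm_right y)
        then show ?thesis using prems by simp
      qed
    qed
    show "opt k l u" if "u < k + l + 1 - N" for u
    proof -
      \<comment> \<open>The witness solves \<open>x + l + 1 - N = u\<close>.\<close>
      have "g (u + N - 1 - l) l = u"
        using less.hyps[of "u + N - 1 - l" l] that prems by simp
      then show ?thesis using opt_left[of "u + N - 1 - l" k l] that prems by simp
    qed
  qed
qed

section \<open>Neither arm congruent to \<open>N\<close>\<close>

lemma mod_less_N: "x mod M \<noteq> N \<Longrightarrow> x mod M < N"
  using mod_less_divisor[of M x] by linarith

lemma mod_diff_self: "M \<le> k \<Longrightarrow> (k - M) mod M = k mod M"
  by (rule le_mod_geq[symmetric])

text \<open>Reply argument: for \<open>k >= M\<close> the star with arm \<open>k - M\<close> has the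
  claimed value by induction and is an option of the star with arm \<open>x\<close>. For
  \<open>k < M\<close> the same move exists in the reduced star.\<close>

lemma generic_left_neq:
  assumes IH: "\<And>a b. a + b < k + l \<Longrightarrow> a mod M \<noteq> N \<Longrightarrow> b mod M \<noteq> N \<Longrightarrow> g a b = g (a mod M) (b mod M)"
    and "k mod M \<noteq> N" "l mod M \<noteq> N" "x < k" "k \<le> x + N"
  shows "g x l \<noteq> g (k mod M) (l mod M)"
proof (cases "M \<le> k")
  case True
  then have "g (k - M) l = g (k mod M) (l mod M)"
    using IH[of "k - M" l] assms mod_diff_self[OF True] by simp
  moreover have "g (k - M) l \<noteq> g x l"
    using True assms by (intro left_neq) auto
  ultimately show ?thesis by simp
next
  case False
  then have "x mod M \<noteq> N" using assms by simp
  then have "g x l = g x (l mod M)" using IH[of x l] assms False by simp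
  then show ?thesis using left_neq[of x k "l mod M"] assms False by simp
qed

text \<open>If \<open>x\<close> and \<open>k\<close> lie in the same block, the reduced star has the
  same move. Otherwise \<open>x\<close> lies in an earlier block and, being close to
  \<open>k\<close>, has a residue above the number of vertices of the reduced star, which bounds its
  value.\<close>

lemma generic_arm_left_neq:
  assumes "x \<le> k" "k + l + 2 \<le> x + N"
  shows "x mod M \<noteq> g (k mod M) (l mod M)"
proof -
  have l: "l mod M = l" using assms by simp
  show ?thesis
  proof (cases "x mod M \<le> k mod M")
    case True
    have "k - x < M" using assms by linarith
    have "k mod M + l + 2 \<le> x mod M + N"
    proof (rule ccontr)
      assume c: "\<not> ?thesis"
      note k = div_expand[of k N] and x = div_expand[of x N]
      have "M * (k div M) < M * (x div M)" using k x c assms by linarith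
      then have "k div M < x div M" by (simp only: mult_less_cancel1)
      then show False using div_le_mono[OF assms(1), of M] by simp
    qed
    then have "opt (k mod M) l (x mod M mod M)" using True by (intro opt_arm_left) auto
    then show ?thesis using not_opt l by auto
  next
    case False
    have "k mod M + l + 3 \<le> x mod M"
    proof (rule ccontr)
      assume c: "\<not> ?thesis"
      note k = div_expand[of k N] and x = div_expand[of x N]
      have "k div M \<noteq> x div M" using False k x assms by (metis add_le_cancel_left)
      then have "x div M + 1 \<le> k div M" using div_le_mono[OF assms(1), of M] by linarith
      then have "M * (x div M + 1) \<le> M * (k div M)" by (rule mult_le_mono2)
      then have "M * (x div M) + M \<le> M * (k div M)" by simp
      then show False using k x c assms by linarith
    qed
    then have "g (k mod M) l < x mod M" using g_le_vertices[of "k mod M" l] by linarith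
    then show ?thesis using l by simp
  qed
qed

lemma generic_left_opt:
  assumes IH: "\<And>a b. a + b < k + l \<Longrightarrow> a mod M \<noteq> N \<Longrightarrow> b mod M \<noteq> N \<Longrightarrow> g a b = g (a mod M) (b mod M)"
    and "k mod M \<noteq> N" "l mod M \<noteq> N" "x < k mod M"
  shows "opt k l (g x (l mod M))"
proof -
  obtain z where z: "z < k" "k \<le> z + N" "z mod M = x"
    using lift_mod assms(4) by blast
  have "x \<noteq> N" using assms mod_less_N[of k] by simp
  then have "g z l = g x (l mod M)" using IH[of z l] z assms by simp
  then show ?thesis using opt_left[OF z(1,2), of l] by simp
qed

text \<open>The value \<open>x\<close> of a move through the centre of the reduced star must be
  recovered. If \<open>l < M\<close>, the move lifts to the block of \<open>k\<close>. If
  \<open>l\<close> is long, the centre cannot be taken this way, and shortening \<open>l\<close>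
  into the previous block gives the same value by \<open>large_base\<close>.\<close>

lemma generic_arm_left_opt:
  assumes IH: "\<And>a b. a + b < k + l \<Longrightarrow> a mod M \<noteq> N \<Longrightarrow> b mod M \<noteq> N \<Longrightarrow> g a b = g (a mod M) (b mod M)"
    and nN: "k mod M \<noteq> N" "l mod M \<noteq> N"
    and x: "x \<le> k mod M" "k mod M + l mod M + 2 \<le> x + N" "x < g (k mod M) (l mod M)"
  shows "opt k l x"
proof -
  have xM: "x mod M = x" using x mod_less_N[OF nN(1)] by simp
  have small: "k mod M + l mod M + 2 \<le> N"
  proof (rule ccontr)
    assume "\<not> ?thesis"
    then have "g (k mod M) (l mod M) = k mod M + l mod M + 1 - N"
      using mod_less_N nN by (intro large_base) auto
    then show False using x by linarith
  qed
  show ?thesis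
  proof (cases "l < M")
    case True
    define z where "z = M * (k div M) + x"
    note k = div_expand[of k N]
    have "z \<le> k" "k + l + 2 \<le> z + N"
      using k x True mod_less[OF True] unfolding z_def by linarith+
    moreover have "z mod M = x"
      using x(1) mod_less_N[OF nN(1)] unfolding z_def by (intro mult_add_mod) linarith
    ultimately show ?thesis using opt_arm_left[of z k l] by simp
  next
    case False
    \<comment> \<open>Chosen so that \<open>k mod M + r + 1 - N = x\<close>. Since
      \<open>r > l mod M\<close>, reaching this residue in the block before that of \<open>l\<close>
      costs fewer than \<open>M\<close> vertices.\<close>
    define r where "r = N - 1 - k mod M + x"
    define y where "y = M * (l div M - 1) + r"
    have r: "r < N" "l mod M < r" "g (k mod M) r = x"
      using small x large_base[of "k mod M" r] nN N_pos mod_less_N[OF nN(1)]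
      unfolding r_def by auto
    have "0 < l div M" using False by (simp add: div_greater_zero_iff)
    then have "M * (l div M - 1) + M = M * (l div M)"
      by (metis Suc_pred' add.commute mult_Suc_right diff_Suc_1 gr0_conv_Suc)
    then have l: "l = M * (l div M - 1) + M + l mod M" using div_expand[of l N] by linarith
    have "y < l" "l \<le> y + N" using l r unfolding y_def by linarith+
    moreover have ym: "y mod M = r" using r unfolding y_def by (intro mult_add_mod) simp
    have "g k y = x" using IH[of k y] ym r nN \<open>y < l\<close> by simp
    ultimately show ?thesis using opt_right[of y l k] by simp
  qed
qed

lemma generic_step:
  assumes IH: "\<And>a b. a + b < k + l \<Longrightarrow> a mod M \<noteq> N \<Longrightarrow> b mod M \<noteq> N \<Longrightarrow> g a b = g (a mod M) (b mod M)"
    and nN: "k mod M \<noteq> N" "l mod M \<noteq> N"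
  shows "g k l = g (k mod M) (l mod M)"
proof (rule g_eqI)
  \<comment> \<open>The mirrored hypothesis lets the lemmas about the left arm be applied with
    \<open>k\<close> and \<open>l\<close> exchanged.\<close>
  have IH': "g a b = g (a mod M) (b mod M)"
    if "a + b < l + k" "a mod M \<noteq> N" "b mod M \<noteq> N" for a b
    using IH[of a b] that by simp
  have leaf_eq: "(k mod M + l mod M + 1) mod M = (k + l + 1) mod M"
    by (metis mod_add_eq mod_add_left_eq)
  show "\<not> opt k l (g (k mod M) (l mod M))"
  proof
    assume "opt k l (g (k mod M) (l mod M))"
    then show False
    proof (cases rule: opt_cases)
      case (left x)
      then show ?thesis using generic_left_neq[OF IH nN] by metis
    next
      case (right y)
      then show ?thesis using generic_left_neq[OF IH' nN(2,1)] g_commute by metis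
    next
      case leaf
      then show ?thesis using opt_leaf[of "k mod M" "l mod M"] not_opt leaf_eq by metis
    next
      case (arm_left x)
      then show ?thesis using generic_arm_left_neq[of x k l] by metis
    next
      case (arm_right y)
      then show ?thesis using generic_arm_left_neq[of y l k] g_commute by (metis add.commute)
    qed
  qed
  show "opt k l u" if u: "u < g (k mod M) (l mod M)" for u
    using opt_less[OF u]
  proof (cases rule: opt_cases)
    case (left x)
    then show ?thesis using generic_left_opt[OF IH nN] by metis
  next
    case (right y)
    then show ?thesis using generic_left_opt[OF IH' nN(2,1)] opt_swap g_commute by metis
  next
    case leaf
    then show ?thesis using opt_leaf[of k l] leaf_eq by simp
  next
    case (arm_left x)
    then have "x mod M = x" using mod_less_N[OF nN(1)] by simp
    then show ?thesis using generic_arm_left_opt[OF IH nN, of x] arm_left u by simp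
  next
    case (arm_right y)
    then have "y mod M = y" using mod_less_N[OF nN(2)] by simp
    then have "opt l k u"
      using generic_arm_left_opt[OF IH' nN(2,1), of y] arm_right u g_commute by (simp add: add.commute)
    then show ?thesis using opt_swap by blast
  qed
qed

lemma generic: "k mod M \<noteq> N \<Longrightarrow> l mod M \<noteq> N \<Longrightarrow> g k l = g (k mod M) (l mod M)"
proof (induction "k + l" arbitrary: k l rule: less_induct)
  case less
  show ?case by (rule generic_step) (use less in auto)
qed

section \<open>Arms congruent to \<open>N\<close>: the value 0, and periodicity in such an
  arm\<close>

lemma both_N_left_neq:
  assumes "k mod M = N" "l mod M = N" "x < k" "k \<le> x + N"
  shows "g x l \<noteq> 0"
proof -
  have "x mod M \<noteq> N" using mod_window assms by metis
  then have x: "x mod M < N" by (rule mod_less_N)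
  \<comment> \<open>The reply: \<open>y\<close> complements the residue of \<open>x\<close> to
    \<open>N - 1\<close>, the boundary on which \<open>large_base\<close> gives 0.\<close>
  then obtain y where y: "y < l" "l \<le> y + N" "y mod M = N - 1 - x mod M"
    using lift_mod[of "N - 1 - x mod M" l] assms(2) by (metis N_pos diff_less less_imp_diff_less less_numeral_extra(1))
  have "g x y = g (x mod M) (N - 1 - x mod M)"
    using generic[of x y] x y by simp
  also have "\<dots> = 0" using x by (subst large_base) auto
  finally show ?thesis using right_neq[OF y(1,2), of x] by simp
qed

text \<open>It suffices that no option is 0. Both arms have at least \<open>N\<close> vertices,
  which rules out the listed moves through the centre, and the path option has residue
  \<open>N\<close>.\<close>

lemma both_N:
  assumes "k mod M = N" "l mod M = N"
  shows "g k l = 0"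
proof (rule g_eqI)
  have kl: "N \<le> k" "N \<le> l"
    using mod_less_eq_dividend[of k M] mod_less_eq_dividend[of l M] assms by metis+
  show "\<not> opt k l 0"
  proof
    assume "opt k l 0"
    then show False
    proof (cases rule: opt_cases)
      case (left x)
      then show ?thesis using both_N_left_neq[of k l x] assms by simp
    next
      case (right y)
      then show ?thesis using both_N_left_neq[of l k y] assms g_commute[of y k] by simp
    next
      case leaf
      have "(k + l + 1) mod M = (k mod M + 1 + l) mod M"
        by (metis add.assoc add.commute mod_add_left_eq)
      also have "k mod M + 1 + l = l + M" using assms by simp
      also have "(l + M) mod M = N" using assms by (simp only: mod_add_self2)
      finally show ?thesis using leaf N_pos by simp
    qed (use kl in auto)
  qed
qed auto

text \<open>Shortening the arm \<open>k - M\<close> meets only residues other than \<open>N\<close>,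
  where \<open>generic\<close> supplies the shift by \<open>M\<close>; shortening \<open>l\<close>
  is covered by induction or by \<open>both_N\<close>. Hence periodicity in this arm starts at
  \<open>N\<close> itself, unlike periodicity in the other arm.\<close>

lemma left_N_period:
  assumes "k mod M = N" "M \<le> k" "l mod M \<noteq> N"
  shows "g k l = g (k - M) l"
  using assms(3)
proof (induction l rule: less_induct)
  case (less l)
  have k1: "(k - M) mod M = N" using assms mod_diff_self by metis
  then have k1N: "N \<le> k - M" using mod_less_eq_dividend by metis
  have right_eq: "g k y = g (k - M) y" if "y < l" for y
    using less.IH[OF that] both_N[OF assms(1), of y] both_N[OF k1, of y] by metis
  have leaf_eq: "(k + l + 1) mod M = (k - M + l + 1) mod M"
    using mod_add_self2[of "k - M + l + 1" M] assms(2)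
    by (metis Nat.add_diff_assoc2 add.assoc add.commute le_add_diff_inverse2)
  show ?case
  proof (rule g_eqI)
    show "\<not> opt k l (g (k - M) l)"
    proof
      assume "opt k l (g (k - M) l)"
      then show False
      proof (cases rule: opt_cases)
        case (left x)
        then show ?thesis using left_neq[of "k - M" x l] assms(2) by simp
      next
        case (right y)
        then show ?thesis using right_neq[of y l "k - M"] right_eq by simp
      next
        case leaf
        then show ?thesis using opt_leaf[of "k - M" l] not_opt leaf_eq by metis
      next
        case (arm_left x)
        then have "opt (k - M) l ((x - M) mod M)"
          using k1N by (intro opt_arm_left) auto
        moreover have "(x - M) mod M = x mod M"
          using arm_left k1N by (intro mod_diff_self) auto
        ultimately show ?thesis using arm_left not_opt by metis
      next
        case (arm_right y)
        then show ?thesis using assms(2) by simp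
      qed
    qed
    show "opt k l u" if "u < g (k - M) l" for u
      using opt_less[OF that]
    proof (cases rule: opt_cases)
      case (left x)
      then have "x mod M \<noteq> N" using mod_window k1 by metis
      then have "g (x + M) l = g x l"
        using generic[of "x + M" l] generic[of x l] less.prems by (simp del: add_Suc_right One_nat_def)
      moreover have "opt k l (g (x + M) l)" using left assms(2) by (intro opt_left) auto
      ultimately show ?thesis using left by simp
    next
      case (right y)
      then show ?thesis using opt_right right_eq by metis
    next
      case leaf
      then show ?thesis using opt_leaf leaf_eq by metis
    next
      case (arm_left x)
      then have "opt k l ((x + M) mod M)" using assms(2) by (intro opt_arm_left) auto
      then show ?thesis using arm_left by (simp only: mod_add_self2)
    next
      case (arm_right y)
      then show ?thesis using k1N by simp
    qed
  qed
qed


section \<open>The column of stars with one arm equal to \<open>N\<close>\<close>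

lemma column_N_left:
  assumes "x < N" "y mod M \<noteq> N"
  shows "g x (y + M) = g x y"
proof -
  have "x mod M \<noteq> N" "(y + M) mod M = y mod M" using assms by (simp_all only: mod_add_self2 mod_less)
  then show ?thesis using generic[of x y] generic[of x "y + M"] assms by metis
qed

text \<open>Shows that shortening the arm \<open>N\<close> yields all values from 0 to
  \<open>x\<close>.\<close>

lemma column_N_row:
  assumes "x < N" "u \<le> x"
  shows "g (N - 1 - x + u) x = u"
  using assms by (subst large_base) auto

text \<open>Values up to \<open>x\<close> are options by \<open>column_N_row\<close>. A value from
  \<open>x + 2\<close> to \<open>N\<close> is an option too, by taking the centre and leaving that
  many vertices of the arm \<open>N\<close>. Only \<open>x + 1\<close> remains.\<close>

lemma column_N_small:
  assumes "x < N" "g N x \<le> N"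
  shows "g N x = x + 1"
proof -
  have "\<not> g N x \<le> x"
  proof
    assume c: "g N x \<le> x"
    then have "g (N - 1 - x + g N x) x = g N x" using assms by (intro column_N_row) auto
    moreover have "N - 1 - x + g N x < N" "N \<le> N - 1 - x + g N x + N" using c assms by linarith+
    ultimately show False using left_neq[of "N - 1 - x + g N x" N x] by blast
  qed
  moreover have "\<not> x + 2 \<le> g N x"
  proof
    assume "x + 2 \<le> g N x"
    then have "opt N x (g N x mod M)" using assms by (intro opt_arm_left) auto
    then show False using not_opt[of N x] assms(2) by simp
  qed
  ultimately show ?thesis by linarith
qed

text \<open>The value \<open>x + 1\<close> survives the shift: a star with it reached by a
  shortening would conflict with \<open>g N x = x + 1\<close>. The path option has residue
  \<open>x\<close>, and moves through the centre are impossible at this length.\<close>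

lemma column_N_small_shift:
  assumes x: "x < N" and le: "g N x \<le> N"
  shows "g N (x + M) = x + 1"
proof (rule g_eqI)
  have gx: "g N x = x + 1" using column_N_small[OF assms] .
  show "\<not> opt N (x + M) (x + 1)"
  proof
    assume "opt N (x + M) (x + 1)"
    then show False
    proof (cases rule: opt_cases)
      case (left z)
      then have "g z x = x + 1" using column_N_left[of z x] x by simp
      then show ?thesis using left_neq[of z N x] left gx by simp
    next
      case (right y)
      \<comment> \<open>The range of \<open>y\<close> lies strictly between \<open>x\<close> and
        \<open>x + M\<close>, so the star with arm \<open>x\<close> is an option of the one with arm
        \<open>y\<close>.\<close>
      then have "y \<noteq> x" by simp
      show ?thesis
      proof (cases "y < x + M \<and> x < y \<and> y \<le> x + N")
        case True
        then show ?thesis using right_neq[of x y N] gx right by simp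
      qed (use right \<open>y \<noteq> x\<close> in linarith)
    next
      case leaf
      have "N + (x + M) + 1 = x + M + M" by simp
      then have "(N + (x + M) + 1) mod M = x" using x by (metis mod_add_self2 mod_less less_SucI)
      then show ?thesis using leaf by simp
    qed auto
  qed
  show "opt N (x + M) u" if "u < x + 1" for u
  proof -
    have "g (N - 1 - x + u) (x + M) = u"
      using column_N_left[of "N - 1 - x + u" x] column_N_row[of x u] that x by simp
    then show ?thesis using opt_left[of "N - 1 - x + u" N "x + M"] that x by simp
  qed
qed

text \<open>Its purpose is to exclude values above \<open>N\<close> among the results of shortening
  the arm \<open>N\<close>.\<close>

lemma row_le_N:
  assumes "x < N" "y < N"
  shows "g x y \<le> N"
proof (cases "N \<le> x + y + 1")
  case True
  then show ?thesis using assms by (subst large_base) auto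
next
  case False
  then show ?thesis using g_le_vertices[of x y] by linarith
qed

text \<open>All moves except shortening \<open>x\<close> give values of at most \<open>N\<close>, so
  larger values are passed down within the column.\<close>

lemma column_N_below:
  assumes "x < N" "N < w" "w < g N x"
  obtains z where "z < x" "g N z = w"
  using opt_less[OF assms(3)]
proof (cases rule: opt_cases)
  case (left z)
  then show ?thesis using row_le_N[of z x] assms by simp
next
  case leaf
  then show ?thesis using mod_less_divisor[of M "N + x + 1"] assms by linarith
next
  case (arm_left z)
  then show ?thesis using mod_less_divisor[of M z] assms by linarith
next
  case (arm_right z)
  then show ?thesis using assms by linarith
qed (use that in auto)

text \<open>Otherwise \<open>g N z\<close> would already occur at some \<open>y < x\<close> by
  \<open>column_N_below\<close>, although \<open>y\<close> is reachable from
  \<open>z\<close>.\<close>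

lemma column_N_mono:
  assumes "x < z" "z < N" "N < g N x" "N < g N z"
  shows "g N x < g N z"
proof (rule ccontr)
  assume "\<not> ?thesis"
  moreover have "g N x \<noteq> g N z" using assms by (intro right_neq) auto
  ultimately have "g N z < g N x" by simp
  then obtain y where "y < x" "g N y = g N z" using column_N_below[of x "g N z"] assms by auto
  then show False using right_neq[of y z N] assms by auto
qed

text \<open>Shortening \<open>x + M\<close> crosses the multiple \<open>M\<close>: the result is
  either \<open>z + M\<close> with \<open>z < x\<close>, or some \<open>z\<close> between
  \<open>x\<close> and \<open>N\<close>, or \<open>N\<close> itself, whose value is 0.\<close>

lemma column_N_shift_below:
  assumes "x < N" "N < w" "w < g N (x + M)"
  shows "(\<exists>z<x. g N (z + M) = w) \<or> (\<exists>z<N. x < z \<and> g N z = w)"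
  using opt_less[OF assms(3)]
proof (cases rule: opt_cases)
  case (left z)
  then show ?thesis using column_N_left[of z x] row_le_N[of z x] assms by simp
next
  case (right y)
  consider "y < N" | "y = N" | z where "y = z + M"
    by (metis Suc_leI le_add_diff_inverse2 linorder_neqE_nat)
  then show ?thesis
  proof cases
    case 2
    then show ?thesis using right both_N[of N N] assms by simp
  qed (use right in auto)
next
  case leaf
  then show ?thesis using mod_less_divisor[of M "N + (x + M) + 1"] assms by linarith
qed auto

text \<open>If \<open>g N x\<close> were below \<open>g N (x + M)\<close>, it would occur as an
  option. At \<open>z + M\<close> with \<open>z < x\<close> this contradicts induction and
  monotonicity; at \<open>z > x\<close> it contradicts the fact that \<open>x\<close> is reachable
  from \<open>z\<close>.\<close>

lemma column_N_shift_le: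
  assumes "x < N" "N < g N (x + M)"
  shows "g N (x + M) \<le> g N x"
  using assms
proof (induction x rule: less_induct)
  case (less x)
  have big: "N < g N z" if "z < N" "N < g N (z + M)" for z
    using column_N_small_shift[of z] that by linarith
  show ?case
  proof (rule ccontr)
    assume "\<not> ?case"
    then consider z where "z < x" "g N (z + M) = g N x" | z where "z < N" "x < z" "g N z = g N x"
      using column_N_shift_below[of x "g N x"] big less.prems by auto
    then show False
    proof cases
      case 1
      then show ?thesis
        using less.IH[of z] column_N_mono[of z x] big[of z] big[of x] less.prems by simp
    next
      case 2
      then show ?thesis using right_neq[of x z N] by simp
    qed
  qed
qed

text \<open>The alternative with \<open>x < z < N\<close> is impossible, since there
  \<open>g N z > g N x >= g N (x + M) > w\<close>.\<close>

lemma column_N_shift_closed: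
  assumes "x < N" "N < w" "w < g N (x + M)"
  obtains z where "z < x" "g N (z + M) = w"
proof -
  have "g N z \<noteq> w" if "z < N" "x < z" for z
  proof
    assume z: "g N z = w"
    have "N < g N x" using column_N_small_shift[of x] assms by linarith
    then have "g N x < w" using column_N_mono[of x z] that z assms by simp
    then show False using column_N_shift_le[of x] assms by linarith
  qed
  then show ?thesis using column_N_shift_below[OF assms] that by blast
qed

text \<open>Options of \<open>l\<close> move up by \<open>M\<close> unless the arm is shortened
  below \<open>M\<close>; only there can the value change under the shift.\<close>

lemma right_period_N:
  assumes "M \<le> l" "l mod M \<noteq> N"
  shows "g N (l + M) = g N l"
  using assms
proof (induction l rule: less_induct)
  case (less l)
  have lM: "(l + M) mod M = l mod M" by (rule mod_add_self2)
  have left_eq: "g x (l + M) = g x l" if "x < N" for x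
    using column_N_left that less.prems by simp
  have leaf_eq: "(N + (l + M) + 1) mod M = (N + l + 1) mod M"
    using mod_add_self2[of "N + l + 1" M] by (simp add: ac_simps del: mod_add_self2)
  show ?case
  proof (rule g_eqI)
    show "\<not> opt N (l + M) (g N l)"
    proof
      assume "opt N (l + M) (g N l)"
      then show False
      proof (cases rule: opt_cases)
        case (left x)
        then show ?thesis using left_eq left_neq[of x N l] by simp
      next
        case (right y)
        then show ?thesis using right_neq[of l y N] by simp
      next
        case leaf
        then show ?thesis using leaf_eq opt_leaf[of N l] not_opt by metis
      qed (use less.prems in auto)
    qed
    show "opt N (l + M) u" if u: "u < g N l" for u
      using opt_less[OF u]
    proof (cases rule: opt_cases)
      case (left x)
      then show ?thesis using opt_left[of x N "l + M"] left_eq by simp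
    next
      case leaf
      then show ?thesis using opt_leaf[of N "l + M"] leaf_eq by metis
    next
      case (right y)
      have opt_y: "opt N (l + M) (g N (y + M))" using right by (intro opt_right) auto
      consider "M \<le> y" "y mod M \<noteq> N" | "y mod M = N" | "y < N" by fastforce
      then show ?thesis
      proof cases
        case 1
        then show ?thesis using less.IH[of y] right opt_y by simp
      next
        case 2
        moreover from 2 have "(y + M) mod M = N" by (simp only: mod_add_self2)
        ultimately show ?thesis using both_N[of N y] both_N[of N "y + M"] right opt_y by simp
      next
        case 3
        \<comment> \<open>Since one move leads from \<open>l\<close> to \<open>y < N\<close>, the
          arm \<open>l\<close> lies in the first block after \<open>M\<close>.\<close>
        define x where "x = l - M"
        have x: "l = x + M" "x < N" using 3 right less.prems unfolding x_def by auto
        show ?thesis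
        proof (cases "u \<le> N")
          case True
          then have "g N (y + M) = u"
            using column_N_small column_N_small_shift 3 right by simp
          then show ?thesis using opt_y by simp
        next
          case False
          \<comment> \<open>A large value may be lost at \<open>y + M\<close>, but it reappears at
            some \<open>z + M\<close> with \<open>z < x\<close>, and by induction at
            \<open>z + M + M\<close>, which is reachable from \<open>l + M\<close>.\<close>
          then obtain z where z: "z < x" "g N (z + M) = u"
            using column_N_shift_closed[of x u] x u by auto
          have "g N (z + M + M) = g N (z + M)"
            using less.IH[of "z + M"] z x mod_add_self2[of z M] mod_less[of z M]
            by (simp del: mod_add_self2)
          moreover have "opt N (l + M) (g N (z + M + M))" using z x 3 right by (intro opt_right) auto
          ultimately show ?thesis using z by simp
        qed
      qed
    qed (use less.prems in auto)
  qed
qed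

section \<open>Collecting the reductions\<close>

lemma right_reduce_N:
  assumes "M \<le> l" "l mod M \<noteq> N"
  shows "g N l = g N (l mod M + M)"
  using assms
proof (induction l rule: less_induct)
  case (less l)
  show ?case
  proof (cases "l < M + M")
    case True
    then show ?thesis using less.prems mod_less[of "l - M" M] le_mod_geq[of M l] by simp
  next
    case False
    define y where "y = l - M"
    have l: "l = y + M" "M \<le> y" using False unfolding y_def by auto
    then have y: "y mod M = l mod M" by (simp only: mod_add_self2)
    then have "g N l = g N y" using right_period_N[of y] l less.prems by simp
    also have "\<dots> = g N (l mod M + M)" using less.IH[of y] l y less.prems by simp
    finally show ?thesis .
  qed
qed

lemma left_reduce_N:
  assumes "k mod M = N" "l mod M \<noteq> N"
  shows "g k l = g N l"
  using assms(1)
proof (induction k rule: less_induct)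
  case (less k)
  show ?case
  proof (cases "k < M")
    case True
    then show ?thesis using less.prems by simp
  next
    case False
    then show ?thesis
      using left_N_period[of k l] less.IH[of "k - M"] less.prems assms(2) mod_diff_self[of k] by simp
  qed
qed

lemma g_periodic:
  "g k l =
    (if k > N \<and> l mod M = N then g (k mod M + M) N
     else if l > N \<and> k mod M = N then g N (l mod M + M)
     else g (k mod M) (l mod M))"
proof -
  have NN: "N mod M = N" by (rule mod_less) simp
  have right_reduce: "g N x = (if N < x then g N (x mod M + M) else g N (x mod M))" if "x mod M \<noteq> N" for x
  proof (cases "N < x")
    case True
    then show ?thesis using right_reduce_N[OF _ that] by (simp only: Suc_le_eq if_True)
  next
    case False
    then have "x mod M = x" by (intro mod_less) simp
    then show ?thesis using False by (simp only: if_False)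
  qed
  consider "k mod M = N" "l mod M = N" | "k mod M = N" "l mod M \<noteq> N"
    | "k mod M \<noteq> N" "l mod M = N" | "k mod M \<noteq> N" "l mod M \<noteq> N" by blast
  then show ?thesis
  proof cases
    \<comment> \<open>The branches of the formula overlap here, but every candidate value is
      0.\<close>
    case 1
    have "g (k mod M + M) N = 0"
      by (rule both_N[OF trans[OF mod_add_self2 trans[OF mod_mod_trivial 1(1)]] NN])
    moreover have "g N (l mod M + M) = 0"
      by (rule both_N[OF NN trans[OF mod_add_self2 trans[OF mod_mod_trivial 1(2)]]])
    moreover have "g (k mod M) (l mod M) = 0"
      by (rule both_N[OF trans[OF mod_mod_trivial 1(1)] trans[OF mod_mod_trivial 1(2)]])
    ultimately show ?thesis using both_N[OF 1] by metis
  next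
    case 2
    then show ?thesis using left_reduce_N[OF 2] right_reduce[OF 2(2)] by metis
  next
    case 3
    have "g k l = g N k" by (rule trans[OF g_commute left_reduce_N[OF 3(2,1)]])
    then show ?thesis using 3 right_reduce[OF 3(1)] g_commute by metis
  next
    case 4
    then show ?thesis using generic[OF 4] by (simp only: simp_thms if_False)
  qed
qed

end

section \<open>Induced subgraphs and paths\<close>

text \<open>The form in which connectedness is exploited: a property constant along arcs cannot
  separate two vertices.\<close>

lemma connected_invariant:
  assumes "connected H" "u \<in> verts H" "v \<in> verts H" "P u"
    and inv: "\<And>a b. a \<rightarrow>\<^bsub>H\<^esub> b \<Longrightarrow> P a \<longleftrightarrow> P b"
  shows "P v"
proof -
  have "(u, v) \<in> rtrancl_on (verts H) ((arcs_ends H)\<^sup>s)"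
    using assms by (simp add: connected_conv)
  then show ?thesis
  proof (induction rule: rtrancl_on_induct)
    case base
    show ?case by fact
  next
    case (step y z)
    then show ?case using inv by (auto simp: symcl_def)
  qed
qed

lemma connected_subgraph_invariant:
  assumes "connected H" "subgraph H G" "u \<in> verts H" "v \<in> verts H" "P u"
    and inv: "\<And>a b. a \<rightarrow>\<^bsub>G\<^esub> b \<Longrightarrow> a \<in> verts H \<Longrightarrow> b \<in> verts H \<Longrightarrow> P a \<longleftrightarrow> P b"
  shows "P v"
proof (rule connected_invariant[of H u v P])
  fix a b assume ab: "a \<rightarrow>\<^bsub>H\<^esub> b"
  interpret wf_digraph H using \<open>subgraph H G\<close> by (simp add: subgraph_def)
  have "a \<rightarrow>\<^bsub>G\<^esub> b" using ab \<open>subgraph H G\<close> by (rule pre_digraph.adj_mono)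
  then show "P a \<longleftrightarrow> P b" using ab inv by auto
qed (use assms in auto)

lemma dominates_induce_iff:
  "u \<rightarrow>\<^bsub>G \<restriction> S\<^esub> v \<longleftrightarrow> u \<rightarrow>\<^bsub>G\<^esub> v \<and> u \<in> S \<and> v \<in> S"
  by (auto simp: arcs_ends_conv)

lemma graph_induce:
  assumes "graph G" "S \<subseteq> verts G"
  shows "graph (G \<restriction> S)"
proof -
  interpret graph G by fact
  have ind: "induced_subgraph (G \<restriction> S) G" using assms(2) by (rule induced_induce)
  interpret S: sym_digraph "G \<restriction> S" by (rule induced_graph_imp_graph[OF ind])
  interpret S: digraph "G \<restriction> S" by (rule digraphI_induced[OF ind])
  show ?thesis by unfold_locales
qed

lemma induce_induce: "T \<subseteq> S \<Longrightarrow> (G \<restriction> S) \<restriction> T = G \<restriction> T"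
  by (auto simp: induce_subgraph_def)

lemma csg_moveI:
  assumes "graph G" "W \<subseteq> verts G" "connected (G \<restriction> W)" "card W \<in> L"
    and "R = verts G - W" "R = {} \<or> connected (G \<restriction> R)"
  shows "csg_move L G (G \<restriction> R)"
proof -
  interpret graph G by fact
  have "subgraph (G \<restriction> W) G" using assms(2) by (rule subgraph_induce_subgraphI)
  then show ?thesis unfolding csg_move_def using assms by (auto intro!: exI[of _ "G \<restriction> W"])
qed

text \<open>Paths are given by an enumeration over an arbitrary vertex type, so that pieces of a
  star count as paths without transporting Grundy values along isomorphisms. The length 0 describes
  the empty graph.\<close>

definition path_graph :: "('a, 'b) pre_digraph \<Rightarrow> (nat \<Rightarrow> 'a) \<Rightarrow> nat \<Rightarrow> bool" where
  "path_graph G p n \<longleftrightarrow> graph G \<and> bij_betw p {..<n} (verts G) \<and>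
     (\<forall>i<n. \<forall>j<n. p i \<rightarrow>\<^bsub>G\<^esub> p j \<longleftrightarrow> i = Suc j \<or> j = Suc i)"

lemma card_path_graph: "path_graph G p n \<Longrightarrow> card (verts G) = n"
  unfolding path_graph_def using bij_betw_same_card by fastforce

lemma path_graph_inj: "path_graph G p n \<Longrightarrow> i < n \<Longrightarrow> j < n \<Longrightarrow> p i = p j \<longleftrightarrow> i = j"
  unfolding path_graph_def bij_betw_def by (auto dest: inj_onD)

lemma verts_path_graph: "path_graph G p n \<Longrightarrow> verts G = p ` {..<n}"
  unfolding path_graph_def bij_betw_def by simp

lemma path_graph_connected:
  assumes P: "path_graph G p n" and "0 < n"
  shows "connected G"
proof -
  interpret graph G using P by (simp add: path_graph_def)
  have V: "verts G = p ` {..<n}" using P by (rule verts_path_graph)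
  have reach: "p 0 \<rightarrow>\<^sup>*\<^bsub>G\<^esub> p i" if "i < n" for i
    using that
  proof (induction i)
    case 0
    then show ?case using V by (intro reachable_refl) auto
  next
    case (Suc i)
    then have "p i \<rightarrow>\<^bsub>G\<^esub> p (Suc i)" using P by (simp add: path_graph_def)
    with Suc show ?case by (meson Suc_lessD reachable_adj_trans)
  qed
  have "u \<rightarrow>\<^sup>*\<^bsub>G\<^esub> v" if "u \<in> verts G" "v \<in> verts G" for u v
    using reach that V by (metis (no_types, lifting) imageE lessThan_iff reachable_trans symmetric_reachable')
  then show ?thesis
    using V \<open>0 < n\<close> by (intro connectedI) (auto intro: reachable_mk_symmetricI)
qed

lemma path_graph_interval:
  assumes P: "path_graph G p n" and "b \<le> n"
  shows "path_graph (G \<restriction> p ` {a..<b}) (\<lambda>i. p (a + i)) (b - a)"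
proof -
  have V: "verts G = p ` {..<n}" using P by (rule verts_path_graph)
  have "graph (G \<restriction> p ` {a..<b})"
    using P V \<open>b \<le> n\<close> by (intro graph_induce) (auto simp: path_graph_def)
  moreover have "bij_betw (\<lambda>i. p (a + i)) {..<b - a} (p ` {a..<b})"
  proof (rule bij_betw_imageI)
    show "inj_on (\<lambda>i. p (a + i)) {..<b - a}"
      using path_graph_inj[OF P] \<open>b \<le> n\<close> by (auto intro!: inj_onI)
    have "(\<lambda>i. p (a + i)) ` {..<b - a} = p ` (+) a ` {0..<b - a}"
      by (simp only: image_image atLeast0LessThan)
    also have "(+) a ` {0..<b - a} = {a..<b}"
    proof (cases "a \<le> b")
      case True
      then show ?thesis by (simp add: image_add_atLeastLessThan)
    qed auto
    finally show "(\<lambda>i. p (a + i)) ` {..<b - a} = p ` {a..<b}" .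
  qed
  moreover have "p (a + i) \<rightarrow>\<^bsub>G \<restriction> p ` {a..<b}\<^esub> p (a + j) \<longleftrightarrow> i = Suc j \<or> j = Suc i"
    if "i < b - a" "j < b - a" for i j
    using that P \<open>b \<le> n\<close> by (auto simp: path_graph_def dominates_induce_iff)
  ultimately show ?thesis by (simp add: path_graph_def)
qed

text \<open>The index set of \<open>R\<close> has no gap, because a missing index would separate the
  smaller from the larger ones; it is therefore the interval from its minimum to its
  maximum.\<close>

lemma path_graph_connected_subset:
  assumes P: "path_graph G p n" and R: "R \<subseteq> verts G" "R = {} \<or> connected (G \<restriction> R)"
  obtains a b where "b \<le> n" "R = p ` {a..<b}"
proof (cases "R = {}")
  case True
  then show ?thesis using that[of 0 0] by simp
next
  case False
  interpret graph G using P by (simp add: path_graph_def)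
  have V: "verts G = p ` {..<n}" using P by (rule verts_path_graph)
  define J where "J = {i. i < n \<and> p i \<in> R}"
  have J: "finite J" "J \<noteq> {}" "R = p ` J" using False R(1) V by (auto simp: J_def)
  have gap: "m \<in> J" if "i \<in> J" "j \<in> J" "i < m" "m < j" for i j m
  proof (rule ccontr)
    assume m: "m \<notin> J"
    have mn: "m < n" using that by (auto simp: J_def)
    \<comment> \<open>The invariant is having an index below the missing \<open>m\<close>; it holds
      at \<open>p i\<close> and fails at \<open>p j\<close>.\<close>
    have "\<exists>t<m. p j = p t"
    proof (rule connected_subgraph_invariant[where H = "G \<restriction> R" and G = G and u = "p i"])
      show "connected (G \<restriction> R)" using R(2) False by blast
      show "subgraph (G \<restriction> R) G" using R(1) by (rule subgraph_induce_subgraphI)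
      fix v w assume vw: "v \<rightarrow>\<^bsub>G\<^esub> w" "v \<in> verts (G \<restriction> R)" "w \<in> verts (G \<restriction> R)"
      then obtain s t where s: "s \<in> J" "v = p s" and t: "t \<in> J" "w = p t" using J by auto
      then have "s = Suc t \<or> t = Suc s"
        using P vw by (auto simp: path_graph_def J_def)
      moreover have "s \<noteq> m" "t \<noteq> m" using s t m by auto
      ultimately have "s < m \<longleftrightarrow> t < m" by linarith
      moreover have "(\<exists>r<m. p q = p r) \<longleftrightarrow> q < m" if "q \<in> J" for q
        using that path_graph_inj[OF P] mn by (fastforce simp: J_def)
      ultimately show "(\<exists>r<m. v = p r) \<longleftrightarrow> (\<exists>r<m. w = p r)" using s t by simp
    qed (use that J in auto)
    then show False using path_graph_inj[OF P] that mn by (fastforce simp: J_def)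
  qed
  have "J = {Min J..<Suc (Max J)}"
  proof
    show "J \<subseteq> {Min J..<Suc (Max J)}" using J by (auto simp: less_Suc_eq_le)
    show "{Min J..<Suc (Max J)} \<subseteq> J"
    proof
      fix m assume "m \<in> {Min J..<Suc (Max J)}"
      then have "Min J \<le> m" "m \<le> Max J" by auto
      moreover have "Min J \<in> J" "Max J \<in> J" using J by auto
      ultimately show "m \<in> J" using gap[of "Min J" "Max J" m] by (metis le_neq_implies_less)
    qed
  qed
  moreover have "Suc (Max J) \<le> n" using Max_in[OF J(1,2)] by (auto simp: J_def)
  ultimately show ?thesis using that J(3) by metis
qed

text \<open>What remains after a move is an interval, hence a path shorter by 1 to \<open>N\<close>
  vertices, with another residue. Conversely, cutting off an end segment reaches every smaller
  residue by \<open>lift_mod\<close>.\<close>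

lemma csg_grundy_path:
  "path_graph G p n \<Longrightarrow> csg_grundy {1..N} G = n mod Suc N"
proof (induction n arbitrary: G p rule: less_induct)
  case (less n)
  note P = less.prems
  interpret graph G using P by (simp add: path_graph_def)
  have V: "verts G = p ` {..<n}" using P by (rule verts_path_graph)
  have inj: "inj_on p {..<n}" using P by (simp add: path_graph_def bij_betw_def)
  show ?case
    unfolding csg_grundy.simps[of _ G]
  proof (rule mex_eqI)
    show "n mod Suc N \<notin> csg_grundy {1..N} ` {G'. csg_move {1..N} G G'}"
    proof
      assume "n mod Suc N \<in> csg_grundy {1..N} ` {G'. csg_move {1..N} G G'}"
      then obtain G' where mv: "csg_move {1..N} G G'" and eq: "csg_grundy {1..N} G' = n mod Suc N"
        by auto
      from mv obtain H where H: "subgraph H G" "card (verts H) \<in> {1..N}"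
        and G': "G' = G \<restriction> (verts G - verts H)" "verts G' = {} \<or> connected G'"
        unfolding csg_move_def by blast
      obtain a b where ab: "b \<le> n" "verts G - verts H = p ` {a..<b}"
        using path_graph_connected_subset[OF P, of "verts G - verts H"] G'
        by (metis Diff_subset induce_subgraph_verts)
      have P': "path_graph G' (\<lambda>i. p (a + i)) (b - a)"
        using path_graph_interval[OF P ab(1), of a] ab(2) G' by simp
      have "verts H \<subseteq> verts G" using H(1) by auto
      then have "b - a = n - card (verts H)"
        using card_path_graph[OF P] card_path_graph[OF P'] G'(1) by (simp add: card_Diff_subset finite_subset)
      moreover have "card (verts H) \<le> n"
        using card_path_graph[OF P] \<open>verts H \<subseteq> verts G\<close> by (metis card_mono finite_verts)
      ultimately have "b - a < n" "n \<le> b - a + N" using H(2) by auto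
      then show False using less.IH[OF _ P'] eq mod_window by metis
    qed
    show "u \<in> csg_grundy {1..N} ` {G'. csg_move {1..N} G G'}" if "u < n mod Suc N" for u
    proof -
      obtain z where z: "z < n" "n \<le> z + N" "z mod Suc N = u"
        using lift_mod \<open>u < n mod Suc N\<close> by blast
      have "path_graph (G \<restriction> p ` {0..<z}) (\<lambda>i. p (0 + i)) (z - 0)"
        using z by (intro path_graph_interval[OF P]) simp
      then have Z: "path_graph (G \<restriction> p ` {0..<z}) p z" by simp
      have W: "path_graph (G \<restriction> p ` {z..<n}) (\<lambda>i. p (z + i)) (n - z)"
        by (intro path_graph_interval[OF P]) simp
      have "csg_move {1..N} G (G \<restriction> p ` {0..<z})"
      proof (rule csg_moveI)
        show "connected (G \<restriction> p ` {z..<n})" using path_graph_connected[OF W] z by simp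
        show "card (p ` {z..<n}) \<in> {1..N}" using card_path_graph[OF W] z by auto
        show "p ` {0..<z} = verts G - p ` {z..<n}"
        proof -
          have "p ` {..<n} - p ` {z..<n} = p ` ({..<n} - {z..<n})"
            by (rule inj_on_image_set_diff[OF inj, symmetric]) auto
          also have "{..<n} - {z..<n} = {0..<z}" using z by auto
          finally show ?thesis using V by simp
        qed
        show "p ` {0..<z} = {} \<or> connected (G \<restriction> p ` {0..<z})"
          using path_graph_connected[OF Z] by (cases "z = 0") auto
      qed (use V graph_axioms in auto)
      moreover have "csg_grundy {1..N} (G \<restriction> p ` {0..<z}) = u" using less.IH[OF z(1) Z] z(3) by simp
      ultimately show ?thesis by blast
    qed
  qed
qed

section \<open>Moves in subdivided stars\<close>

lemma star_dominates:
  "u \<rightarrow>\<^bsub>subdivided_star ls\<^esub> v \<longleftrightarrow> (u, v) \<in> star_links ls \<or> (v, u) \<in> star_links ls"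
  by (force simp: arcs_ends_conv subdivided_star_def)

lemma verts_subdivided_star: "verts (subdivided_star ls) = star_verts ls"
  by (simp add: subdivided_star_def)

lemma in_star_verts:
  "None \<in> star_verts ls" "Some (i, j) \<in> star_verts ls \<longleftrightarrow> i < length ls \<and> j < ls ! i"
  by (auto simp: star_verts_def)

lemma star_dominates_simps:
  "None \<rightarrow>\<^bsub>subdivided_star ls\<^esub> Some (i, j) \<longleftrightarrow> i < length ls \<and> j = 0 \<and> 0 < ls ! i"
  "Some (i, j) \<rightarrow>\<^bsub>subdivided_star ls\<^esub> None \<longleftrightarrow> i < length ls \<and> j = 0 \<and> 0 < ls ! i"
  "\<not> None \<rightarrow>\<^bsub>subdivided_star ls\<^esub> None"
  "Some (i, j) \<rightarrow>\<^bsub>subdivided_star ls\<^esub> Some (i', j') \<longleftrightarrow>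
     i < length ls \<and> i' = i \<and> j < ls ! i \<and> j' < ls ! i \<and> (j' = Suc j \<or> j = Suc j')"
  unfolding star_dominates star_links_def by auto

text \<open>Positions are counted from the centre, so shortening arms at their outer ends keeps all
  labels and the result is literally a star, not just an isomorphic copy.\<close>

lemma induce_subdivided_star:
  assumes "length ls' = length ls" "\<And>i. i < length ls \<Longrightarrow> ls' ! i \<le> ls ! i"
  shows "subdivided_star ls \<restriction> star_verts ls' = subdivided_star ls'"
proof -
  have links: "(u, v) \<in> star_links ls' \<longleftrightarrow> (u, v) \<in> star_links ls \<and> u \<in> star_verts ls' \<and> v \<in> star_verts ls'" for u v
    using assms(1) by (auto simp: star_links_def star_verts_def intro: less_le_trans[OF _ assms(2)])
  show ?thesis
    unfolding induce_subgraph_def subdivided_star_def using links by auto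
qed

definition arm :: "nat \<Rightarrow> nat \<Rightarrow> nat \<Rightarrow> (nat \<times> nat) option set" where
  "arm i a b = (\<lambda>j. Some (i, j)) ` {a..<b}"

lemma in_arm [simp]: "None \<notin> arm i a b" "Some (i', j) \<in> arm i a b \<longleftrightarrow> i' = i \<and> a \<le> j \<and> j < b"
  by (auto simp: arm_def)

lemma card_arm: "card (arm i a b) = b - a"
  unfolding arm_def by (subst card_image) (auto intro: inj_onI)

lemma arm_subset: "i < length ls \<Longrightarrow> b \<le> ls ! i \<Longrightarrow> arm i a b \<subseteq> star_verts ls"
  by (auto simp: arm_def star_verts_def)

lemma induce_shortened_star:
  assumes "i < length ls" "x \<le> ls ! i"
  shows "subdivided_star ls \<restriction> star_verts (ls[i := x]) = subdivided_star (ls[i := x])"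
  by (rule induce_subdivided_star) (use assms in \<open>auto simp: nth_list_update\<close>)

lemma star_verts_shortened:
  assumes "i < length ls" "x \<le> ls ! i"
  shows "star_verts (ls[i := x]) = star_verts ls - arm i x (ls ! i)"
proof -
  have "w \<in> star_verts (ls[i := x]) \<longleftrightarrow> w \<in> star_verts ls - arm i x (ls ! i)" for w
    using assms by (cases w) (auto simp: in_star_verts nth_list_update split: if_splits)
  then show ?thesis by blast
qed

lemma arm_path_graph:
  assumes "i < length ls" "b \<le> ls ! i"
  shows "path_graph (subdivided_star ls \<restriction> arm i a b) (\<lambda>t. Some (i, a + t)) (b - a)"
proof -
  have "path_graph (subdivided_star ls \<restriction> arm i 0 (ls ! i)) (\<lambda>t. Some (i, t)) (ls ! i)"
    unfolding path_graph_def
  proof (intro conjI allI impI)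
    show "graph (subdivided_star ls \<restriction> arm i 0 (ls ! i))"
      using assms arm_subset by (intro graph_induce graph_subdivided_star) (simp add: verts_subdivided_star)
    show "bij_betw (\<lambda>t. Some (i, t)) {..<ls ! i} (verts (subdivided_star ls \<restriction> arm i 0 (ls ! i)))"
      by (auto simp: bij_betw_def arm_def intro: inj_onI)
  qed (use assms in \<open>auto simp: dominates_induce_iff star_dominates_simps\<close>)
  from path_graph_interval[OF this assms(2), of a]
  show ?thesis
    using assms by (subst (asm) induce_induce) (auto simp: arm_def)
qed

lemma arm_connected:
  assumes "i < length ls" "b \<le> ls ! i" "a < b"
  shows "connected (subdivided_star ls \<restriction> arm i a b)"
  using path_graph_connected[OF arm_path_graph[OF assms(1,2), of a]] assms(3) by simp

text \<open>With the leaf gone, the star is a path, numbered from the outer end of the first long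
  arm through the centre at \<open>k\<close> to the outer end of the second.\<close>

lemma two_arms_path_graph:
  "path_graph (subdivided_star [0, k, l])
     (\<lambda>t. if t < k then Some (1, k - 1 - t) else if t = k then None else Some (2, t - k - 1)) (k + l + 1)"
  (is "path_graph ?S ?p ?n")
  unfolding path_graph_def
proof (intro conjI allI impI)
  have idx: "i < 3 \<longleftrightarrow> i = 0 \<or> i = 1 \<or> i = 2" for i :: nat by auto
  show "bij_betw ?p {..<?n} (verts ?S)"
  proof (rule bij_betw_imageI)
    show "inj_on ?p {..<?n}" by (rule inj_onI) (auto split: if_splits)
    show "?p ` {..<?n} = verts ?S"
    proof
      show "?p ` {..<?n} \<subseteq> verts ?S" by (auto simp: verts_subdivided_star star_verts_def)
      show "verts ?S \<subseteq> ?p ` {..<?n}"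
      proof
        fix v assume v: "v \<in> verts ?S"
        show "v \<in> ?p ` {..<?n}"
        proof (cases v)
          case None
          then show ?thesis by (intro image_eqI[of _ _ k]) auto
        next
          case (Some ij)
          then obtain i j where ij: "v = Some (i, j)" by (cases ij) auto
          then consider "i = 1" "j < k" | "i = 2" "j < l"
            using v by (auto simp: verts_subdivided_star in_star_verts numeral_3_eq_3 less_Suc_eq numeral_2_eq_2)
          then show ?thesis
          proof cases
            case 1
            then show ?thesis using ij by (intro image_eqI[of _ _ "k - 1 - j"]) auto
          next
            case 2
            then show ?thesis using ij by (intro image_eqI[of _ _ "k + 1 + j"]) auto
          qed
        qed
      qed
    qed
  qed
  fix i j assume "i < ?n" "j < ?n"
  then show "?p i \<rightarrow>\<^bsub>?S\<^esub> ?p j \<longleftrightarrow> i = Suc j \<or> j = Suc i"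
    by (auto simp: star_dominates_simps)
qed (rule graph_subdivided_star)


text \<open>A connected set avoiding the centre stays in one arm. Whatever lies beyond a removed
  vertex is cut off from the surviving centre and must be removed too, so the set is an outer
  segment.\<close>

lemma centre_remains:
  assumes H: "subgraph H (subdivided_star ls)" "connected H"
    and R: "connected (subdivided_star ls \<restriction> (star_verts ls - verts H))" "None \<notin> verts H"
  obtains i x where "i < length ls" "x < ls ! i" "verts H = arm i x (ls ! i)"
    "star_verts ls - verts H = star_verts (ls[i := x])"
proof -
  let ?S = "subdivided_star ls" and ?R = "star_verts ls - verts H"
  interpret graph ?S by (rule graph_subdivided_star)
  have sub: "verts H \<subseteq> star_verts ls" using H(1) unfolding subgraph_def verts_subdivided_star by blast
  have "verts H \<noteq> {}" using H(2) by (auto simp: connected_conv)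
  then obtain v where "v \<in> verts H" by blast
  then obtain i j where v: "Some (i, j) \<in> verts H" using R(2) by (cases v) auto
  have one_arm: "i' = i" if "Some (i', j') \<in> verts H" for i' j'
  proof -
    have "\<exists>j''. Some (i', j') = Some (i, j'')"
    proof (rule connected_subgraph_invariant[OF H(2,1) v that])
      fix a b assume "a \<rightarrow>\<^bsub>?S\<^esub> b" "a \<in> verts H" "b \<in> verts H"
      then show "(\<exists>j. a = Some (i, j)) \<longleftrightarrow> (\<exists>j. b = Some (i, j))"
        using R(2) by (cases a; cases b) (auto simp: star_dominates_simps)
    qed auto
    then show ?thesis by simp
  qed
  have final: "Some (i, s) \<in> verts H" if s: "Some (i, t) \<in> verts H" "t \<le> s" "s < ls ! i" for s t
  proof (rule ccontr)
    assume ns: "Some (i, s) \<notin> verts H"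
    have il: "i < length ls" using v sub in_star_verts by blast
    \<comment> \<open>The invariant is lying beyond position \<open>t\<close> on arm
      \<open>i\<close>. With \<open>t\<close> removed, no remaining arc changes it, yet it fails at
      the centre.\<close>
    have "\<exists>q>t. None = Some (i, q)"
    proof (rule connected_subgraph_invariant[OF R(1)])
      show "subgraph (?S \<restriction> ?R) ?S"
        by (rule subgraph_induce_subgraphI) (auto simp: verts_subdivided_star)
      show "Some (i, s) \<in> verts (?S \<restriction> ?R)" using ns s il by (simp add: in_star_verts)
      show "None \<in> verts (?S \<restriction> ?R)" using R(2) by (simp add: in_star_verts)
      show "\<exists>q>t. Some (i, s) = Some (i, q)" using ns s by (metis le_neq_implies_less)
      fix a b assume ab: "a \<rightarrow>\<^bsub>?S\<^esub> b" "a \<in> verts (?S \<restriction> ?R)" "b \<in> verts (?S \<restriction> ?R)"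
      then have "a \<noteq> Some (i, t)" "b \<noteq> Some (i, t)" using s by auto
      then show "(\<exists>q>t. a = Some (i, q)) \<longleftrightarrow> (\<exists>q>t. b = Some (i, q))"
        using ab(1) by (cases a; cases b) (auto simp: star_dominates_simps)
    qed
    then show False by simp
  qed
  define x where "x = (LEAST t. Some (i, t) \<in> verts H)"
  have x: "Some (i, x) \<in> verts H" unfolding x_def using v by (rule LeastI)
  then have xi: "i < length ls" "x < ls ! i" using sub in_star_verts by blast+
  have "Some (i', t) \<in> verts H \<longleftrightarrow> i' = i \<and> x \<le> t \<and> t < ls ! i" for i' t
    using one_arm final[OF x] sub in_star_verts(2) by (metis Least_le subsetD x_def)
  then have "w \<in> verts H \<longleftrightarrow> w \<in> arm i x (ls ! i)" for w
    using R(2) by (cases w) auto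
  then have Harm: "verts H = arm i x (ls ! i)" by blast
  show ?thesis
    using that[OF xi Harm] star_verts_shortened[of i ls x] xi Harm by simp
qed

text \<open>All arcs between different arms pass through the centre; this describes what is left
  once the centre is taken.\<close>

lemma connected_without_centre:
  assumes "R \<subseteq> star_verts ls" "None \<notin> R" "connected (subdivided_star ls \<restriction> R)"
  obtains i where "i < length ls" "R \<subseteq> arm i 0 (ls ! i)"
proof -
  let ?S = "subdivided_star ls"
  interpret graph ?S by (rule graph_subdivided_star)
  have "R \<noteq> {}" using assms(3) by (auto simp: connected_conv)
  then obtain v where "v \<in> R" by blast
  then obtain i j where v: "Some (i, j) \<in> R" using assms(2) by (cases v) auto
  have one_arm: "\<exists>j. w = Some (i, j)" if "w \<in> R" for w
  proof (rule connected_subgraph_invariant[OF assms(3)])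
    show "subgraph (?S \<restriction> R) ?S"
      using assms(1) by (intro subgraph_induce_subgraphI) (simp add: verts_subdivided_star)
    fix a b assume "a \<rightarrow>\<^bsub>?S\<^esub> b" "a \<in> verts (?S \<restriction> R)" "b \<in> verts (?S \<restriction> R)"
    then show "(\<exists>j. a = Some (i, j)) \<longleftrightarrow> (\<exists>j. b = Some (i, j))"
      using assms(2) by (cases a; cases b) (auto simp: star_dominates_simps)
  qed (use v that in auto)
  have "R \<subseteq> arm i 0 (ls ! i)"
  proof
    fix w assume w: "w \<in> R"
    then obtain t where "w = Some (i, t)" using one_arm by blast
    then show "w \<in> arm i 0 (ls ! i)" using w assms(1) in_star_verts(2) by auto
  qed
  moreover have "i < length ls" using v assms(1) in_star_verts(2) by blast
  ultimately show ?thesis using that by blast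
qed

lemma csg_grundy_within_arm:
  assumes "i < length ls" "R \<subseteq> arm i 0 (ls ! i)"
    and "R = {} \<or> connected (subdivided_star ls \<restriction> R)"
  shows "csg_grundy {1..N} (subdivided_star ls \<restriction> R) = card R mod Suc N"
proof -
  let ?A = "subdivided_star ls \<restriction> arm i 0 (ls ! i)"
  have A: "path_graph ?A (\<lambda>t. Some (i, 0 + t)) (ls ! i - 0)"
    using assms(1) by (intro arm_path_graph) auto
  have RA: "?A \<restriction> R = subdivided_star ls \<restriction> R" using assms(2) by (rule induce_induce)
  obtain a b where ab: "b \<le> ls ! i - 0" "R = (\<lambda>t. Some (i, 0 + t)) ` {a..<b}"
    using path_graph_connected_subset[OF A, of R] assms RA by (metis induce_subgraph_verts)
  from path_graph_interval[OF A ab(1), of a]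
  have P: "path_graph (subdivided_star ls \<restriction> R) (\<lambda>t. Some (i, 0 + (a + t))) (b - a)"
    unfolding ab(2)[symmetric] RA .
  show ?thesis using csg_grundy_path[OF P] card_path_graph[OF P] by simp
qed

abbreviation star1 :: "nat \<Rightarrow> nat \<Rightarrow> ((nat \<times> nat) option, (nat \<times> nat) option \<times> (nat \<times> nat) option) pre_digraph" where
  "star1 k l \<equiv> subdivided_star [1, k, l]"

lemma card_star_verts: "card (star_verts ls) = Suc (sum_list ls)"
  using card_subdivided_star[of ls] by (simp add: verts_subdivided_star)

lemma finite_star_verts: "finite (star_verts ls)"
  by (simp add: star_verts_conv)

lemma less_3_cases: "i < 3 \<Longrightarrow> i = 0 \<or> i = 1 \<or> i = (2 :: nat)"
  by auto

text \<open>If the centre stays, one arm is shortened. If it goes, the rest is a segment of one arm,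
  and counting vertices turns the limit \<open>N\<close> into
  \<open>k + l + 2 <= card ?R + N\<close>.\<close>

lemma star1_move_opt:
  assumes mv: "csg_move {1..N} (star1 k l) G'"
  shows "star_opt N (\<lambda>k l. csg_grundy {1..N} (star1 k l)) k l (csg_grundy {1..N} G')"
proof -
  let ?ls = "[1, k, l]" and ?g = "\<lambda>k l. csg_grundy {1..N} (star1 k l)"
  from mv obtain H where H: "subgraph H (star1 k l)" "connected H" "card (verts H) \<in> {1..N}"
    and G': "G' = star1 k l \<restriction> (star_verts ?ls - verts H)" "verts G' = {} \<or> connected G'"
    unfolding csg_move_def verts_subdivided_star by blast
  let ?R = "star_verts ?ls - verts H"
  have sub: "verts H \<subseteq> star_verts ?ls" using H(1) unfolding subgraph_def verts_subdivided_star by blast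
  show ?thesis
  proof (cases "None \<in> verts H")
    case False
    then have "None \<in> verts G'" using G'(1) in_star_verts(1) by simp
    then have "connected (star1 k l \<restriction> ?R)" using G' by auto
    then obtain i x where ix: "i < length ?ls" "x < ?ls ! i" "verts H = arm i x (?ls ! i)"
        "?R = star_verts (?ls[i := x])"
      using centre_remains[OF H(1,2)] False by metis
    have card: "?ls ! i - x \<le> N" using H(3) ix(3) card_arm by simp
    have G'_star: "G' = subdivided_star (?ls[i := x])"
      unfolding G'(1) ix(4) using ix(1,2) by (intro induce_shortened_star) auto
    consider "i = 0" | "i = 1" | "i = 2" using ix(1) less_3_cases[of i] by auto
    then show ?thesis
    proof cases
      case 1
      then have "G' = subdivided_star [0, k, l]" using G'_star ix by simp
      then show ?thesis
        using csg_grundy_path[OF two_arms_path_graph] by (simp add: star_opt_def)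
    next
      case 2
      then have "G' = star1 x l" using G'_star by simp
      then show ?thesis using 2 ix card by (auto simp: star_opt_def)
    next
      case 3
      then have "G' = star1 k x" using G'_star by (simp add: numeral_2_eq_2)
      then show ?thesis using 3 ix card by (auto simp: star_opt_def numeral_2_eq_2)
    qed
  next
    case True
    have disj: "?R = {} \<or> connected (star1 k l \<restriction> ?R)" using G' by auto
    obtain i where i: "i < length ?ls" "?R \<subseteq> arm i 0 (?ls ! i)"
    proof (cases "?R = {}")
      case True
      then show ?thesis
        using that[of 0] by (metis empty_subsetI length_greater_0_conv list.distinct(1))
    next
      case False
      then show ?thesis using connected_without_centre[of ?R ?ls] True disj that by blast
    qed
    have val: "csg_grundy {1..N} G' = card ?R mod Suc N"
      unfolding G'(1) using csg_grundy_within_arm[OF i disj] .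
    have "card (arm i 0 (?ls ! i)) = ?ls ! i" by (simp add: card_arm)
    then have le: "card ?R \<le> ?ls ! i"
      using card_mono[OF _ i(2)] by (metis arm_def finite_atLeastLessThan finite_imageI)
    have "card ?R = k + l + 2 - card (verts H)"
      using card_Diff_subset[OF finite_subset[OF sub finite_star_verts] sub] card_star_verts[of ?ls] by simp
    then have cardR: "k + l + 2 \<le> card ?R + N" using H(3) unfolding atLeastAtMost_iff by linarith
    consider "i = 0" | "i = 1" | "i = 2" using i(1) less_3_cases[of i] by auto
    then show ?thesis
    proof cases
      case 1
      then have "card ?R \<le> 1" using le by simp
      \<comment> \<open>At most the leaf is left. This looks like an empty or one-vertex remainder
        of a long arm, or, if both long arms are empty, like the path option.\<close>
      then have "card ?R \<le> k \<or> card ?R \<le> l \<or> card ?R = k + l + 1" by linarith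
      then show ?thesis
        unfolding val star_opt_def using cardR by metis
    next
      case 2
      then have "card ?R \<le> k" using le by simp
      then show ?thesis unfolding val star_opt_def using cardR by blast
    next
      case 3
      then have "card ?R \<le> l" using le by (simp add: numeral_2_eq_2)
      then show ?thesis unfolding val star_opt_def using cardR by blast
    qed
  qed
qed

lemma shorten_arm_move:
  assumes "i < length ls" "x < ls ! i" "ls ! i - x \<in> L"
  shows "csg_move L (subdivided_star ls) (subdivided_star (ls[i := x]))"
proof -
  have R: "subdivided_star ls \<restriction> star_verts (ls[i := x]) = subdivided_star (ls[i := x])"
    using assms by (intro induce_shortened_star) auto
  have "csg_move L (subdivided_star ls) (subdivided_star ls \<restriction> star_verts (ls[i := x]))"
  proof (rule csg_moveI[OF graph_subdivided_star])
    show "arm i x (ls ! i) \<subseteq> verts (subdivided_star ls)"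
      using assms arm_subset by (simp add: verts_subdivided_star)
    show "connected (subdivided_star ls \<restriction> arm i x (ls ! i))"
      using assms by (intro arm_connected) auto
    show "star_verts (ls[i := x]) = verts (subdivided_star ls) - arm i x (ls ! i)"
      using assms star_verts_shortened[of i ls x] by (simp add: verts_subdivided_star)
  qed (use assms R connected_subdivided_star in \<open>auto simp: card_arm\<close>)
  then show ?thesis using R by simp
qed

text \<open>The removed set is itself a shortened star, hence connected, and the kept set is an
  outer segment of one arm.\<close>

lemma keep_arm_end_move:
  assumes i: "i < length ls" "x \<le> ls ! i" and L: "Suc (sum_list ls) - x \<in> L"
  shows "csg_move L (subdivided_star ls) (subdivided_star ls \<restriction> arm i (ls ! i - x) (ls ! i))"
proof (rule csg_moveI[OF graph_subdivided_star])
  let ?W = "star_verts (ls[i := ls ! i - x])" and ?A = "arm i (ls ! i - x) (ls ! i)"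
  have W: "?W = star_verts ls - ?A" using i by (intro star_verts_shortened) auto
  have A: "?A \<subseteq> star_verts ls" using i by (intro arm_subset) auto
  show "?W \<subseteq> verts (subdivided_star ls)" using W by (auto simp: verts_subdivided_star)
  have "subdivided_star ls \<restriction> ?W = subdivided_star (ls[i := ls ! i - x])"
    using i by (intro induce_shortened_star) auto
  then show "connected (subdivided_star ls \<restriction> ?W)" using connected_subdivided_star by simp
  have "card ?W = Suc (sum_list ls) - x"
    unfolding W using A i
    by (subst card_Diff_subset) (auto simp: card_star_verts card_arm finite_subset[OF _ finite_star_verts])
  then show "card ?W \<in> L" using L by simp
  show "?A = verts (subdivided_star ls) - ?W" using W A by (auto simp: verts_subdivided_star)
  show "?A = {} \<or> connected (subdivided_star ls \<restriction> ?A)"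
    using arm_connected[of i ls "ls ! i" "ls ! i - x"] i
    by (cases "x = 0 \<or> ls ! i = 0") (auto simp: arm_def)
qed

lemma csg_grundy_arm_end:
  assumes "i < length ls" "x \<le> ls ! i"
  shows "csg_grundy {1..N} (subdivided_star ls \<restriction> arm i (ls ! i - x) (ls ! i)) = x mod Suc N"
  using csg_grundy_path[OF arm_path_graph[OF assms(1) order.refl]] assms(2) by simp

lemma star1_opt_move:
  assumes "0 < N" and "star_opt N (\<lambda>k l. csg_grundy {1..N} (star1 k l)) k l u"
  shows "u \<in> csg_grundy {1..N} ` {G'. csg_move {1..N} (star1 k l) G'}"
proof -
  have move: ?thesis if "csg_move {1..N} (star1 k l) G'" "csg_grundy {1..N} G' = u" for G'
    using that by blast
  from assms(2) consider
      x where "x < k" "k \<le> x + N" "u = csg_grundy {1..N} (star1 x l)"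
    | y where "y < l" "l \<le> y + N" "u = csg_grundy {1..N} (star1 k y)"
    | "u = (k + l + 1) mod Suc N"
    | x where "x \<le> k" "k + l + 2 \<le> x + N" "u = x mod Suc N"
    | y where "y \<le> l" "k + l + 2 \<le> y + N" "u = y mod Suc N"
    unfolding star_opt_def by blast
  then show ?thesis
  proof cases
    case 1
    then have "k - x \<in> {1..N}" by auto
    then show ?thesis
      using shorten_arm_move[of 1 "[1, k, l]" x "{1..N}"] 1 by (intro move) simp_all
  next
    case 2
    then have "l - y \<in> {1..N}" by auto
    then show ?thesis
      using shorten_arm_move[of 2 "[1, k, l]" y "{1..N}"] 2
      by (intro move) (simp_all add: numeral_2_eq_2)
  next
    case 3
    show ?thesis
    proof (rule move)
      \<comment> \<open>The path option is realised by removing the single leaf, which needs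
        \<open>1 <= N\<close>.\<close>
      show "csg_move {1..N} (star1 k l) (subdivided_star [0, k, l])"
        using shorten_arm_move[of 0 "[1, k, l]" 0 "{1..N}"] assms(1) by simp
    qed (use csg_grundy_path[OF two_arms_path_graph] 3 in simp)
  next
    case 4
    then have "Suc (sum_list [1, k, l]) - x \<in> {1..N}" by auto
    then show ?thesis
      using keep_arm_end_move[of 1 "[1, k, l]" x "{1..N}"] csg_grundy_arm_end[of 1 "[1, k, l]" x N] 4
      by (intro move) simp_all
  next
    case 5
    then have "Suc (sum_list [1, k, l]) - y \<in> {1..N}" by auto
    then show ?thesis
      using keep_arm_end_move[of 2 "[1, k, l]" y "{1..N}"] csg_grundy_arm_end[of 2 "[1, k, l]" y N] 5
      by (intro move) (simp_all add: numeral_2_eq_2)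
  qed
qed

text \<open>The two inclusions between values of moves and options turn the definition of the Grundy
  value into the recursion of the locale.\<close>

lemma star_game_csg_grundy:
  assumes "0 < N"
  shows "star_game N (\<lambda>k l. csg_grundy {1..N} (star1 k l))"
proof
  fix k l
  show "csg_grundy {1..N} (star1 k l) =
      mex {u. star_opt N (\<lambda>k l. csg_grundy {1..N} (star1 k l)) k l u}"
    by (subst csg_grundy.simps, rule arg_cong[where f = mex])
      (use star1_move_opt star1_opt_move[OF assms] in blast)
qed (rule assms)

theorem theorem10:
  fixes N k l :: nat
  assumes "N \<ge> 3"
  shows "csg_grundy {1..N} (subdivided_star [1, k, l]) =
    (if k > N \<and> l mod (N + 1) = N then
       csg_grundy {1..N} (subdivided_star [1, k mod (N + 1) + N + 1, N])
     else if l > N \<and> k mod (N + 1) = N then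
       csg_grundy {1..N} (subdivided_star [1, N, l mod (N + 1) + N + 1])
     else
       csg_grundy {1..N} (subdivided_star [1, k mod (N + 1), l mod (N + 1)]))"
proof -
  interpret star_game N "\<lambda>k l. csg_grundy {1..N} (star1 k l)"
    using assms by (intro star_game_csg_grundy) simp
  show ?thesis using g_periodic[of k l] by simp
qed

end
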